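(* Let $E$ be a JB$^*$-triple. Then the following are equivalent: (a) $E$ is commutative. (b) There exists $\gamma>0$ satisfying $$\big\|\{a,b,\{x,y,z\}\}\big\|\leq \gamma \, \big\|\{x,y,\{a,b,z\}\}\big\| \quad \text{for all } a,b,x,y,z\in E.$$
   Context: A JB$^*$-triple is a complex Banach space $E$ equipped with a continuous triple product $\{\cdot,\cdot,\cdot\}:E\times E\times E\to E$ which is linear and symmetric in the outer variables and conjugate linear in the middle one, and satisfies, writing $L(a,b)(x)=\{a,b,x\}$ for $a,b,x\in E$: (i) $L(a,b)L(x,y)-L(x,y)L(a,b)=L(L(a,b)x,y)-L(x,L(b,a)y)$ for all $a,b,x,y\in E$ (Jordan identity); (ii) for each $a\in E$, $L(a,a)$ is a hermitian operator (i.e. $\|e^{itL(a,a)}\|=1$ for all real $t$) with non-negative spectrum; (iii) $\|\{a,a,a\}\|=\|a\|^3$ for every $a\in E$. A JB$^*$-triple $E$ is called commutative if $L(a,b)L(x,y)=L(x,y)L(a,b)$ as operators on $E$ for all $a,b,x,y\in E$. *)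

theory Defs
  imports "HOL-Analysis.Analysis"
begin

text \<open>
  The library has no class of complex Banach spaces, so complex scalar multiplication is added
  to a real Banach space, compatibly with its real scalar multiplication and its norm.
\<close>

locale complex_banach = vector_space scaleC
  for scaleC :: "complex \<Rightarrow> 'a::banach \<Rightarrow> 'a" +
  assumes scaleC_of_real: "scaleC (complex_of_real r) x = r *\<^sub>R x"
    and norm_scaleC: "norm (scaleC k x) = cmod k * norm x"
begin

definition bounded_clinear :: "('a \<Rightarrow> 'a) \<Rightarrow> bool" where
  "bounded_clinear T \<longleftrightarrow>
     Vector_Spaces.linear scaleC scaleC T \<and> (\<exists>K. \<forall>x. norm (T x) \<le> norm x * K)"

definition op_spectrum :: "('a \<Rightarrow> 'a) \<Rightarrow> complex set" where
  "op_spectrum T = {k. \<not> (\<exists>S. bounded_clinear S \<and>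
     S \<circ> (\<lambda>x. T x - scaleC k x) = id \<and> (\<lambda>x. T x - scaleC k x) \<circ> S = id)}"

text \<open>
  The exponential series is summed pointwise, which for a bounded operator agrees with the sum in
  operator norm. (The class-based function \<open>exp\<close> does not apply to operators, as these do not
  form an instance of a normed algebra class.)
\<close>

definition op_exp :: "('a \<Rightarrow> 'a) \<Rightarrow> 'a \<Rightarrow> 'a" where
  "op_exp T x = (\<Sum>n. (T ^^ n) x /\<^sub>R fact n)"

definition hermitian_op :: "('a \<Rightarrow> 'a) \<Rightarrow> bool" where
  "hermitian_op T \<longleftrightarrow> bounded_clinear T \<and>
     (\<forall>t::real. onorm (op_exp (\<lambda>x. scaleC (\<i> * complex_of_real t) (T x))) = 1)"

end

text \<open>The operator \<open>L a b\<close> of the text is the partial application \<open>trip a b\<close>.\<close>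

locale JB_star_triple = complex_banach scaleC
  for scaleC :: "complex \<Rightarrow> 'a::banach \<Rightarrow> 'a" +
  fixes trip :: "'a \<Rightarrow> 'a \<Rightarrow> 'a \<Rightarrow> 'a"
  assumes continuous_trip: "continuous_on UNIV (\<lambda>(a, b, c). trip a b c)"
    and linear_outer: "Vector_Spaces.linear scaleC scaleC (\<lambda>a. trip a b c)"
    and symmetric_outer: "trip a b c = trip c b a"
    and add_middle: "trip a (b + b') c = trip a b c + trip a b' c"
    and scale_middle: "trip a (scaleC k b) c = scaleC (cnj k) (trip a b c)"
    and jordan_identity:
      "trip a b (trip x y z) - trip x y (trip a b z) =
         trip (trip a b x) y z - trip x (trip b a y) z"
    and hermitian: "hermitian_op (trip a a)"
    and nonneg_spectrum: "op_spectrum (trip a a) \<subseteq> \<real>\<^sub>\<ge>\<^sub>0"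
    and norm_cube: "norm (trip a a a) = norm a ^ 3"

definition commutative_triple :: "('a \<Rightarrow> 'a \<Rightarrow> 'a \<Rightarrow> 'a) \<Rightarrow> bool" where
  "commutative_triple trip \<longleftrightarrow>
     (\<forall>a b x y. trip a b \<circ> trip x y = trip x y \<circ> trip a b)"

end

theory Submission
  imports Defs
begin

text \<open>
  Write \<open>{a, b, c}\<close> for \<open>trip a b c\<close> and \<open>L(a, b)\<close> for \<open>trip a b\<close>. That the inequality forces
  commutativity is an analogue of Le Page's theorem on Banach algebras with
  \<open>\<parallel>u v\<parallel> \<le> \<gamma> \<parallel>v u\<parallel>\<close>, and like it is an application of Liouville's theorem.

  By the Jordan identity, \<open>exp (l L(a, b))\<close> is, for every complex \<open>l\<close>, an automorphism of the
  triple product up to a companion map \<open>exp (- cnj l L(b, a))\<close> in the middle slot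
  (\<open>trip_expo\<close>). Put \<open>p = exp (l L(a, b)) x\<close> and \<open>q = exp (- cnj l L(b, a)) y\<close>. Then
  \<open>L(p, q)\<close> is the conjugate of \<open>L(x, y)\<close> by \<open>exp (l L(a, b))\<close>, and so it is a power series
  in \<open>l\<close> whose coefficient of \<open>l\<close> is the commutator of \<open>L(a, b)\<close> and \<open>L(x, y)\<close> (\<open>box_expo\<close>).
  It remains to bound \<open>L(p, q)\<close> uniformly in \<open>l\<close>.

  A naive bound grows like \<open>exp (c \<bar>l\<bar>)\<close>. However, the automorphism property carries powers to
  powers: with \<open>p\<^sub>0 = p\<close> and \<open>p\<^sub>n\<^sub>+\<^sub>1 = {p\<^sub>n, q, p\<^sub>n}\<close>, and likewise \<open>x\<^sub>n\<close> from \<open>x\<close> and \<open>y\<close>,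
  one has \<open>p\<^sub>n = exp (l L(a, b)) x\<^sub>n\<close>. Hence \<open>\<parallel>L(p\<^sub>n, q)\<parallel>\<close> is at most a constant that depends on
  \<open>l\<close> times \<open>s ^ 2 ^ n\<close>, where \<open>s\<close> does not depend on \<open>l\<close>. The constant disappears after
  taking roots of order \<open>2 ^ n\<close>, provided that \<open>\<parallel>L(u, q)\<parallel>\<^sup>2 \<le> M \<parallel>L({u, q, u}, q)\<parallel>\<close> for all
  \<open>u\<close> and \<open>q\<close>. This last inequality (\<open>norm_trip_squared_le\<close>) is where the hypothesis enters: it
  permits, at the cost of a factor \<open>\<gamma>\<close>, to rearrange the entries in
  \<open>\<parallel>v\<parallel> ^ 3 = \<parallel>{v, v, v}\<parallel>\<close> for \<open>v = {u, q, z}\<close>.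
\<close>

section \<open>Cauchy products and exponentials of bounded operators\<close>

text \<open>
  The difference between the sums over the square \<open>i, j < n\<close> and over the triangle \<open>i + j < n\<close> is
  dominated by the same difference for the numerical series of norms, which tends to \<open>0\<close> by the
  Cauchy product theorem for real series.
\<close>

lemma bounded_bilinear_Cauchy_product_sums:
  fixes prod :: "'u::banach \<Rightarrow> 'v::banach \<Rightarrow> 'w::banach" (infixl "\<bullet>\<bullet>" 70)
  assumes bil: "bounded_bilinear (\<bullet>\<bullet>)"
    and f: "summable (\<lambda>k. norm (f k))" and g: "summable (\<lambda>k. norm (g k))"
  shows "(\<lambda>k. \<Sum>i\<le>k. f i \<bullet>\<bullet> g (k - i)) sums ((\<Sum>k. f k) \<bullet>\<bullet> (\<Sum>k. g k))"
proof -
  interpret bounded_bilinear "(\<bullet>\<bullet>)" by (rule bil)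
  obtain K where K: "\<And>a b. norm (a \<bullet>\<bullet> b) \<le> K * (norm a * norm b)"
    using bounded by (metis mult.commute)
  define square where "square n = {..<n} \<times> {..<n}" for n :: nat
  define triangle where "triangle n = {(i, j). i + j < n}" for n :: nat
  have fin: "finite (square n)" and sub: "triangle n \<subseteq> square n" for n
    by (auto simp: square_def triangle_def)
  define G where "G = (\<lambda>(i, j). f i \<bullet>\<bullet> g j)"
  define H where "H = (\<lambda>(i, j). norm (f i) * norm (g j))"
  have G_square: "(\<lambda>n. sum G (square n)) \<longlonglongrightarrow> (\<Sum>k. f k) \<bullet>\<bullet> (\<Sum>k. g k)"
  proof -
    have "(\<lambda>n. (\<Sum>k<n. f k) \<bullet>\<bullet> (\<Sum>k<n. g k)) \<longlonglongrightarrow> (\<Sum>k. f k) \<bullet>\<bullet> (\<Sum>k. g k)"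
      by (intro tendsto summable_LIMSEQ summable_norm_cancel[OF f] summable_norm_cancel[OF g])
    moreover have "(\<Sum>k<n. f k) \<bullet>\<bullet> (\<Sum>k<n. g k) = sum G (square n)" for n
      unfolding G_def square_def sum_left sum_right
      by (subst sum.swap) (rule sum.cartesian_product)
    ultimately show ?thesis by simp
  qed
  have H_square: "(\<lambda>n. sum H (square n)) \<longlonglongrightarrow> (\<Sum>k. norm (f k)) * (\<Sum>k. norm (g k))"
  proof -
    have "(\<lambda>n. (\<Sum>k<n. norm (f k)) * (\<Sum>k<n. norm (g k)))
        \<longlonglongrightarrow> (\<Sum>k. norm (f k)) * (\<Sum>k. norm (g k))"
      by (intro tendsto_mult summable_LIMSEQ f g)
    then show ?thesis
      by (simp add: H_def square_def sum_product sum.cartesian_product)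
  qed
  have H_triangle: "(\<lambda>n. sum H (triangle n)) \<longlonglongrightarrow> (\<Sum>k. norm (f k)) * (\<Sum>k. norm (g k))"
    using Cauchy_product_sums[of "\<lambda>k. norm (f k)" "\<lambda>k. norm (g k)"] f g
    by (simp add: sums_def H_def triangle_def sum.triangle_reindex)
  have majorant: "(\<lambda>n. K * (sum H (square n) - sum H (triangle n))) \<longlonglongrightarrow> 0"
    using tendsto_mult[OF tendsto_const[of K] tendsto_diff[OF H_square H_triangle]] by simp
  have "norm (sum G (square n) - sum G (triangle n))
      \<le> K * (sum H (square n) - sum H (triangle n))" for n
  proof -
    have "norm (sum G (square n - triangle n)) \<le> (\<Sum>x\<in>square n - triangle n. K * H x)"
      by (rule order_trans[OF norm_sum sum_mono]) (auto simp: G_def H_def K mult_ac)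
    then show ?thesis
      using fin[of n] sub[of n] by (simp add: sum_diff sum_distrib_left[symmetric])
  qed
  then have "(\<lambda>n. sum G (square n) - sum G (triangle n)) \<longlonglongrightarrow> 0"
    by (intro Lim_null_comparison[OF always_eventually majorant] allI)
  with G_square have "(\<lambda>n. sum G (triangle n)) \<longlonglongrightarrow> (\<Sum>k. f k) \<bullet>\<bullet> (\<Sum>k. g k)"
    by (rule Lim_transform2)
  then show ?thesis
    by (simp add: sums_def G_def triangle_def sum.triangle_reindex)
qed

definition expo_term :: "('v::banach \<Rightarrow> 'v) \<Rightarrow> 'v \<Rightarrow> nat \<Rightarrow> 'v" where
  "expo_term T x n = (T ^^ n) x /\<^sub>R fact n"

definition expo :: "('v::banach \<Rightarrow> 'v) \<Rightarrow> 'v \<Rightarrow> 'v" where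
  "expo T x = (\<Sum>n. expo_term T x n)"

lemma expo_term_0: "expo_term T x 0 = x"
  by (simp add: expo_term_def)

lemma expo_term_Suc:
  assumes "bounded_linear T"
  shows "real (Suc n) *\<^sub>R expo_term T x (Suc n) = T (expo_term T x n)"
proof -
  interpret bounded_linear T by fact
  have "real (Suc n) *\<^sub>R expo_term T x (Suc n) = inverse (fact n) *\<^sub>R (T ^^ Suc n) x"
    by (simp add: expo_term_def field_simps del: of_nat_Suc)
  then show ?thesis by (simp add: expo_term_def scaleR)
qed

text \<open>The recursion \<open>(n + 1) h\<^sub>n\<^sub>+\<^sub>1 = T h\<^sub>n\<close> is the differential equation \<open>h' = T h\<close>
  in terms of power series coefficients, so it determines the coefficients.\<close>

lemma expo_term_unique:
  assumes T: "bounded_linear T"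
    and "\<And>n. real (Suc n) *\<^sub>R h (Suc n) = T (h n)" and "h 0 = x"
  shows "h n = expo_term T x n"
proof (induction n)
  case 0
  then show ?case using assms by (simp add: expo_term_0)
next
  case (Suc n)
  have "real (Suc n) *\<^sub>R h (Suc n) = real (Suc n) *\<^sub>R expo_term T x (Suc n)"
    using Suc assms expo_term_Suc[OF T] by metis
  then show ?case by (simp del: of_nat_Suc)
qed

lemma norm_funpow_le:
  fixes T :: "'v::banach \<Rightarrow> 'v"
  assumes "\<And>x. norm (T x) \<le> k * norm x" and "k \<ge> 0"
  shows "norm ((T ^^ n) x) \<le> k ^ n * norm x"
proof (induction n)
  case (Suc n)
  have "norm ((T ^^ Suc n) x) \<le> k * norm ((T ^^ n) x)" using assms by simp
  also have "\<dots> \<le> k * (k ^ n * norm x)" using Suc assms by (intro mult_left_mono) auto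
  finally show ?case by (simp add: mult_ac)
qed simp

lemma norm_expo_term_le:
  assumes "\<And>x. norm (T x) \<le> k * norm x" and "k \<ge> 0"
  shows "norm (expo_term T x n) \<le> (k ^ n /\<^sub>R fact n) * norm x"
  using norm_funpow_le[OF assms, of n x]
  by (simp add: expo_term_def field_simps)

lemma summable_norm_expo_term:
  assumes "bounded_linear T"
  shows "summable (\<lambda>n. norm (expo_term T x n))"
proof -
  obtain k where k: "\<And>x. norm (T x) \<le> k * norm x" "k \<ge> 0"
    using bounded_linear.nonneg_bounded[OF assms] by (auto simp: mult.commute)
  show ?thesis
    by (rule summable_comparison_test'[OF summable_mult2[OF summable_exp_generic[of k]]])
       (use norm_expo_term_le[OF k] in auto)
qed

lemma norm_expo_le:
  assumes "bounded_linear T"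
  shows "\<exists>C\<ge>0. \<forall>x. norm (expo T x) \<le> C * norm x"
proof -
  obtain k where k: "\<And>x. norm (T x) \<le> k * norm x" "k \<ge> 0"
    using bounded_linear.nonneg_bounded[OF assms] by (auto simp: mult.commute)
  have "norm (expo T x) \<le> exp k * norm x" for x
  proof -
    have "norm (expo T x) \<le> (\<Sum>n. (k ^ n /\<^sub>R fact n) * norm x)"
      unfolding expo_def
      by (rule norm_suminf_le[OF norm_expo_term_le[OF k]
            summable_mult2[OF summable_exp_generic[of k]]])
    also have "\<dots> = exp k * norm x"
      unfolding exp_def by (rule suminf_mult2[OF summable_exp_generic, symmetric])
    finally show ?thesis .
  qed
  then show ?thesis by (intro exI[of _ "exp k"]) auto
qed

text \<open>
  If \<open>R\<close> acts on a product by the Leibniz rule, then its exponential acts multiplicatively. The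
  coefficients of the Cauchy product of the two series on the right satisfy the
  recursion that characterises the exponential series of \<open>R\<close>. Allowing three different spaces
  makes the lemma cover both the conjugation of operators and their evaluation at vectors.
\<close>

lemma expo_bilinear:
  fixes prod :: "'u::banach \<Rightarrow> 'v::banach \<Rightarrow> 'w::banach" (infixl "\<bullet>\<bullet>" 70)
  assumes bil: "bounded_bilinear (\<bullet>\<bullet>)"
    and P: "bounded_linear P" and Q: "bounded_linear Q" and R: "bounded_linear R"
    and deriv: "\<And>u v. R (u \<bullet>\<bullet> v) = P u \<bullet>\<bullet> v + u \<bullet>\<bullet> Q v"
  shows "expo R (u \<bullet>\<bullet> v) = expo P u \<bullet>\<bullet> expo Q v"
proof -
  interpret bounded_bilinear "(\<bullet>\<bullet>)" by (rule bil)
  let ?f = "expo_term P u" and ?g = "expo_term Q v"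
  define h where "h n = (\<Sum>i\<le>n. ?f i \<bullet>\<bullet> ?g (n - i))" for n
  have "h = expo_term R (u \<bullet>\<bullet> v)"
  proof (rule ext, rule expo_term_unique[OF R])
    show "h 0 = u \<bullet>\<bullet> v" by (simp add: h_def expo_term_0)
    fix n
    \<comment> \<open>Split the weight \<open>n + 1\<close> of the \<open>i\<close>-th summand as \<open>i + (n + 1 - i)\<close>.\<close>
    have "real (Suc n) *\<^sub>R h (Suc n)
        = (\<Sum>i\<le>Suc n. (real i *\<^sub>R ?f i) \<bullet>\<bullet> ?g (Suc n - i) + ?f i \<bullet>\<bullet> (real (Suc n - i) *\<^sub>R ?g (Suc n - i)))"
      unfolding h_def scaleR_sum_right
      by (intro sum.cong refl)
         (simp add: scaleR_left scaleR_right scaleR_add_left[symmetric] of_nat_diff del: of_nat_Suc)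
    also have "\<dots> = (\<Sum>i\<le>Suc n. (real i *\<^sub>R ?f i) \<bullet>\<bullet> ?g (Suc n - i))
        + (\<Sum>i\<le>Suc n. ?f i \<bullet>\<bullet> (real (Suc n - i) *\<^sub>R ?g (Suc n - i)))"
      by (rule sum.distrib)
    also have "(\<Sum>i\<le>Suc n. (real i *\<^sub>R ?f i) \<bullet>\<bullet> ?g (Suc n - i)) = (\<Sum>i\<le>n. P (?f i) \<bullet>\<bullet> ?g (n - i))"
      by (subst sum.atMost_Suc_shift) (simp add: expo_term_Suc[OF P] zero_left del: of_nat_Suc)
    also have "(\<Sum>i\<le>Suc n. ?f i \<bullet>\<bullet> (real (Suc n - i) *\<^sub>R ?g (Suc n - i))) = (\<Sum>i\<le>n. ?f i \<bullet>\<bullet> Q (?g (n - i)))"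
    proof -
      have "?f i \<bullet>\<bullet> (real (Suc n - i) *\<^sub>R ?g (Suc n - i)) = ?f i \<bullet>\<bullet> Q (?g (n - i))" if "i \<le> n" for i
        using expo_term_Suc[OF Q, of "n - i" v] that by (simp only: Suc_diff_le)
      then show ?thesis by (simp add: zero_right)
    qed
    also have "(\<Sum>i\<le>n. P (?f i) \<bullet>\<bullet> ?g (n - i)) + (\<Sum>i\<le>n. ?f i \<bullet>\<bullet> Q (?g (n - i))) = R (h n)"
      unfolding h_def linear_sum[OF bounded_linear.linear[OF R]] deriv
      by (rule sum.distrib[symmetric])
    finally show "real (Suc n) *\<^sub>R h (Suc n) = R (h n)" .
  qed
  moreover have "h sums (expo P u \<bullet>\<bullet> expo Q v)"
    unfolding h_def expo_def
    by (intro bounded_bilinear_Cauchy_product_sums[OF bil] summable_norm_expo_term P Q)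
  ultimately show ?thesis
    by (simp add: expo_def[of R] sums_iff)
qed

section \<open>Liouville's theorem for vector-valued power series\<close>

context complex_banach
begin

lemma bounded_linear_scaleC_right: "bounded_linear (scaleC k)"
proof (rule bounded_linear_intro[where K = "cmod k"])
  show "scaleC k (x + y) = scaleC k x + scaleC k y" for x y by (rule scale_right_distrib)
  show "scaleC k (r *\<^sub>R x) = r *\<^sub>R scaleC k x" for r x
    by (simp add: scaleC_of_real[symmetric] mult.commute)
  show "norm (scaleC k x) \<le> norm x * cmod k" for x by (simp add: norm_scaleC)
qed

text \<open>
  A discrete form of the Cauchy estimate: averaging the values at the points \<open>r w ^ k\<close>, with
  \<open>w\<close> a primitive root of unity of order \<open>N\<close>, against the weights \<open>w ^ (- m k)\<close> keeps, among the
  terms of degree less than \<open>N\<close>, only the one of degree \<open>m\<close>, while the terms of degree at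
  least \<open>N\<close> are negligible for large \<open>N\<close>. This avoids vector-valued integration, and also
  linear functionals.
\<close>

lemma bounded_entire_series_coeff_zero:
  assumes summable: "\<And>r. r > 0 \<Longrightarrow> summable (\<lambda>n. r ^ n * norm (c n))"
    and bound: "\<And>l. norm (\<Sum>n. scaleC (l ^ n) (c n)) \<le> B"
    and "m > 0"
  shows "c m = 0"
proof (rule ccontr)
  assume "c m \<noteq> 0"
  have Cauchy_bound: "r ^ m * norm (c m) \<le> B" if r: "r > 0" for r
  proof (rule field_le_epsilon)
    fix e :: real assume "e > 0"
    from suminf_exist_split[OF this summable[OF r]] obtain N0 where
      N0: "\<And>n. n \<ge> N0 \<Longrightarrow> norm (\<Sum>i. r ^ (i + n) * norm (c (i + n))) < e" by blast
    define N where "N = N0 + m + 1"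
    have N: "N > m" "N \<ge> N0" by (auto simp: N_def)
    define w where "w n = cis (2 * pi * real n / real N)" for n
    define v where "v = inverse (w m)"
    have w_pow: "w 1 ^ n = w n" for n
      by (simp add: w_def Complex.DeMoivre mult_ac)
    have cmod_w [simp]: "cmod (w n) = 1" and cmod_v [simp]: "cmod v = 1" for n
      by (simp_all add: w_def v_def norm_inverse)
    have w_nz: "w n \<noteq> 0" for n by (simp add: w_def)
    have w_N: "w n ^ N = 1" for n
      using N by (simp add: w_def Complex.DeMoivre)
    have filter: "(\<Sum>k<N. (w n * v) ^ k) = (if n = m then of_nat N else 0)" if "n < N" for n
    proof (cases "n = m")
      case True
      then show ?thesis using w_nz by (simp add: v_def)
    next
      case False
      have "inj_on w {..<N}"
        using Complex.bij_betw_roots_unity[of N] N unfolding w_def bij_betw_def by auto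
      then have "w n \<noteq> w m" using False that N by (auto dest: inj_onD)
      then have "w n * v \<noteq> 1" using w_nz[of m] by (auto simp: v_def field_simps)
      moreover have "(w n * v) ^ N = 1"
        by (simp add: v_def power_mult_distrib power_inverse w_N)
      ultimately show ?thesis using False by (simp add: geometric_sum)
    qed
    \<comment> \<open>\<open>N\<close> times the average of the terms of degree \<open>n\<close>\<close>
    define h where "h n = scaleC (complex_of_real (r ^ n) * (\<Sum>k<N. (w n * v) ^ k)) (c n)" for n
    define l where "l k = complex_of_real r * w k" for k
    have summable_l: "summable (\<lambda>n. scaleC (l k ^ n) (c n))" for k
      by (rule summable_norm_cancel)
         (use r in \<open>simp add: norm_scaleC l_def norm_mult norm_power summable\<close>)
    have wk: "w k ^ n = w n ^ k" for k n
      by (metis w_pow power_mult mult.commute)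
    have h_eq: "h n = (\<Sum>k<N. scaleC (v ^ k) (scaleC (l k ^ n) (c n)))" for n
      by (simp add: h_def l_def wk sum_distrib_left power_mult_distrib mult_ac scale_sum_left)
    have norm_h: "norm (h n) \<le> real N * (r ^ n * norm (c n))" for n
    proof -
      have "norm (h n) \<le> (\<Sum>k<N. r ^ n * norm (c n))"
        unfolding h_eq using r
        by (intro order_trans[OF norm_sum] sum_mono)
           (simp add: norm_scaleC l_def norm_mult norm_power)
      then show ?thesis by simp
    qed
    have summable_h: "summable h"
      by (rule summable_comparison_test'[OF summable_mult[OF summable[OF r]]])
         (rule norm_h)
    have "suminf h = (\<Sum>k<N. scaleC (v ^ k) (\<Sum>n. scaleC (l k ^ n) (c n)))"
      unfolding h_eq
      by (simp only: bounded_linear.suminf[OF bounded_linear_scaleC_right summable_l]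
          suminf_sum bounded_linear.summable[OF bounded_linear_scaleC_right summable_l])
    also have "norm \<dots> \<le> (\<Sum>k<N. B)"
      by (intro order_trans[OF norm_sum] sum_mono) (simp add: norm_scaleC norm_power bound)
    finally have upper: "norm (suminf h) \<le> real N * B" by simp
    have "(\<Sum>n<N. h n) = (\<Sum>n<N. if n = m then h m else 0)"
      by (intro sum.cong refl) (auto simp: h_def filter)
    then have head: "(\<Sum>n<N. h n) = h m" using N by simp
    have "norm (h m) = real N * (r ^ m * norm (c m))"
      using N r by (simp add: h_def filter norm_scaleC norm_mult norm_power)
    moreover have "h m = suminf h - (\<Sum>n. h (n + N))"
      using suminf_split_initial_segment[OF summable_h, of N] head by simp
    moreover have "norm (\<Sum>n. h (n + N)) \<le> real N * e"
    proof -
      have s: "summable (\<lambda>n. r ^ (n + N) * norm (c (n + N)))"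
        using summable[OF r] by (subst summable_iff_shift)
      have "norm (\<Sum>n. h (n + N)) \<le> (\<Sum>n. real N * (r ^ (n + N) * norm (c (n + N))))"
        by (rule norm_suminf_le[OF norm_h summable_mult[OF s]])
      also have "\<dots> = real N * (\<Sum>n. r ^ (n + N) * norm (c (n + N)))"
        by (rule suminf_mult[OF s])
      also have "\<dots> \<le> real N * e"
        using N0[OF N(2)] by (intro mult_left_mono) auto
      finally show ?thesis .
    qed
    ultimately have "real N * (r ^ m * norm (c m)) \<le> real N * (B + e)"
      using upper norm_triangle_ineq4[of "suminf h" "\<Sum>n. h (n + N)"]
      by (simp add: distrib_left)
    then show "r ^ m * norm (c m) \<le> B + e" using N by simp
  qed
  define r where "r = (\<bar>B\<bar> + 1) / norm (c m) + 1"
  have "r * norm (c m) = \<bar>B\<bar> + 1 + norm (c m)"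
    using \<open>c m \<noteq> 0\<close> by (simp add: r_def field_simps)
  then have r: "r \<ge> 1" "r * norm (c m) > B"
    using norm_ge_zero[of "c m"] by (auto simp: r_def simp del: norm_ge_zero)
  have "r \<le> r ^ m" using r \<open>m > 0\<close> by (simp add: self_le_power)
  then have "r * norm (c m) \<le> r ^ m * norm (c m)" by (intro mult_right_mono) auto
  then show False using Cauchy_bound[of r] r by linarith
qed

end

section \<open>Triple products\<close>

context JB_star_triple
begin

lemma trip_add_left: "trip (a + a') b c = trip a b c + trip a' b c"
  using linear_outer[of b c] by (simp add: Vector_Spaces.linear_def module_hom_iff)

lemma trip_scaleC_left: "trip (scaleC k a) b c = scaleC k (trip a b c)"
  using linear_outer[of b c] by (simp add: Vector_Spaces.linear_def module_hom_iff)

lemma trip_add_right: "trip a b (c + c') = trip a b c + trip a b c'"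
  by (metis symmetric_outer trip_add_left)

lemma trip_scaleC_right: "trip a b (scaleC k c) = scaleC k (trip a b c)"
  by (metis symmetric_outer trip_scaleC_left)

lemma trip_scaleR:
  "trip (r *\<^sub>R a) b c = r *\<^sub>R trip a b c" "trip a (r *\<^sub>R b) c = r *\<^sub>R trip a b c"
  "trip a b (r *\<^sub>R c) = r *\<^sub>R trip a b c"
  using trip_scaleC_left[of "complex_of_real r"] scale_middle[of _ "complex_of_real r"]
    trip_scaleC_right[of _ _ "complex_of_real r"]
  by (simp_all add: scaleC_of_real)

lemma trip_zero: "trip 0 b c = 0" "trip a 0 c = 0" "trip a b 0 = 0"
  using trip_scaleR(1)[of 0] trip_scaleR(2)[of _ 0] trip_scaleR(3)[of _ _ 0] by simp_all

text \<open>
  As for multilinear maps, continuity at the origin yields the bound by homogeneity.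
\<close>

lemma norm_trip_le: "\<exists>K>0. \<forall>a b c. norm (trip a b c) \<le> K * norm a * norm b * norm c"
proof -
  have "isCont (\<lambda>(a, b, c). trip a b c) (0, 0, 0)"
    using continuous_trip by (simp add: continuous_on_eq_continuous_at)
  then obtain d where "d > 0" and
    d: "\<And>x. dist x (0, 0, 0) < d \<Longrightarrow> dist (case x of (a, b, c) \<Rightarrow> trip a b c) (trip 0 0 0) < 1"
    unfolding continuous_at_eps_delta by (metis (mono_tags, lifting) case_prod_conv zero_less_one)
  define e where "e = d / 4"
  have e: "e > 0" using \<open>d > 0\<close> by (simp add: e_def)
  have small: "norm (trip a b c) \<le> 1" if "norm a = e" "norm b = e" "norm c = e" for a b c
  proof -
    have "norm (a, b, c) \<le> norm a + (norm b + norm c)"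
      by (meson norm_Pair_le order_trans add_left_mono)
    also have "\<dots> < d" using that \<open>d > 0\<close> by (simp add: e_def)
    finally have "dist (a, b, c) (0, 0, 0) < d"
      by (simp add: dist_norm)
    from d[OF this] show ?thesis by (simp add: trip_zero)
  qed
  have "norm (trip a b c) \<le> (1 / e ^ 3) * norm a * norm b * norm c" for a b c
  proof (cases "a = 0 \<or> b = 0 \<or> c = 0")
    case True
    then show ?thesis by (auto simp: trip_zero)
  next
    case False
    have "norm (trip ((e / norm a) *\<^sub>R a) ((e / norm b) *\<^sub>R b) ((e / norm c) *\<^sub>R c)) \<le> 1"
      using False e by (intro small) auto
    then show ?thesis
      using False e by (simp add: trip_scaleR field_simps power3_eq_cube)
  qed
  then show ?thesis using e by (intro exI[of _ "1 / e ^ 3"]) auto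
qed

lemma bounded_linear_trip: "bounded_linear (trip a b)"
proof -
  obtain K where K: "\<And>a b c. norm (trip a b c) \<le> K * norm a * norm b * norm c"
    using norm_trip_le by blast
  show ?thesis
    by (rule bounded_linear_intro[where K = "K * norm a * norm b"])
       (use K[of a b] in \<open>auto simp: trip_add_right trip_scaleR mult_ac\<close>)
qed

text \<open>
  \<open>L(a, b)\<close> as an element of the Banach space of bounded operators, so that the exponential series
  of a commutator with it makes sense.
\<close>

definition box :: "'a \<Rightarrow> 'a \<Rightarrow> 'a \<Rightarrow>\<^sub>L 'a" where
  "box a b = Blinfun (trip a b)"

lemma box_apply [simp]: "blinfun_apply (box a b) c = trip a b c"
  by (simp add: box_def bounded_linear_Blinfun_apply bounded_linear_trip)

lemma bounded_bilinear_box: "bounded_bilinear box"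
proof -
  obtain K where K: "K > 0" "\<And>a b c. norm (trip a b c) \<le> K * norm a * norm b * norm c"
    using norm_trip_le by blast
  have "norm (box a b) \<le> norm a * norm b * K" for a b
    using K(1) K(2)[of a b] by (intro norm_blinfun_bound) (auto simp: mult_ac)
  then show ?thesis
    by unfold_locales
       (auto intro!: blinfun_eqI
         simp: blinfun.bilinear_simps trip_add_left add_middle trip_scaleR)
qed

definition ad :: "'a \<Rightarrow> 'a \<Rightarrow> ('a \<Rightarrow>\<^sub>L 'a) \<Rightarrow> ('a \<Rightarrow>\<^sub>L 'a)" where
  "ad a b M = (box a b o\<^sub>L M) - (M o\<^sub>L box a b)"

lemma ad_apply: "blinfun_apply (ad a b M) z = trip a b (M z) - M (trip a b z)"
  by (simp add: ad_def blinfun.bilinear_simps)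

lemma bounded_linear_ad: "bounded_linear (ad a b)"
  unfolding ad_def
  by (intro bounded_linear_sub
      bounded_bilinear.bounded_linear_left[OF bounded_bilinear_blinfun_compose]
      bounded_bilinear.bounded_linear_right[OF bounded_bilinear_blinfun_compose])

text \<open>
  The Jordan identity as a Leibniz rule for \<open>box\<close>. The sign sits in the middle slot, so the
  companion of \<open>L(a, b)\<close> there is \<open>- L(b, a)\<close>.
\<close>

lemma ad_box: "ad a b (box x y) = box (trip a b x) y + box x (- trip b a y)"
proof (rule blinfun_eqI)
  fix z
  have "trip x (- trip b a y) z = - trip x (trip b a y) z"
    using trip_scaleR(2)[of x "-1" "trip b a y" z] by simp
  then show "blinfun_apply (ad a b (box x y)) z = (box (trip a b x) y + box x (- trip b a y)) z"
    using jordan_identity[of a b x y z] by (simp add: ad_apply blinfun.bilinear_simps)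
qed

lemma box_expo:
  "box (expo (trip a b) x) (expo (\<lambda>u. - trip b a u) y) = expo (ad a b) (box x y)"
  by (rule expo_bilinear[symmetric, OF bounded_bilinear_box])
     (auto intro: bounded_linear_trip bounded_linear_minus bounded_linear_ad simp: ad_box)

text \<open>
  Evaluation of operators at vectors obeys the Leibniz rule for \<open>ad a b\<close> and \<open>L(a, b)\<close> by the
  very definition of a commutator. Together with \<open>box_expo\<close> this makes \<open>exp L(a, b)\<close> an automorphism
  of the triple product, up to its companion \<open>exp (- L(b, a))\<close> in the middle slot.
\<close>

lemma trip_expo:
  "trip (expo (trip a b) x) (expo (\<lambda>u. - trip b a u) y) (expo (trip a b) z)
    = expo (trip a b) (trip x y z)"
proof -
  have "expo (trip a b) (blinfun_apply (box x y) z)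
      = blinfun_apply (expo (ad a b) (box x y)) (expo (trip a b) z)"
    by (rule expo_bilinear[OF bounded_bilinear_blinfun_apply])
       (auto intro: bounded_linear_trip bounded_linear_ad simp: ad_apply)
  then show ?thesis by (simp add: box_expo[symmetric])
qed

text \<open>
  Replacing \<open>a\<close> by \<open>l a\<close> turns \<open>L(a, b)\<close> into \<open>l L(a, b)\<close>, and \<open>L(b, a)\<close> into \<open>cnj l L(b, a)\<close>.
  So the complex parameter needs no separate treatment in the exponentials; its powers
  reappear in the coefficients of the series.
\<close>

lemma funpow_ad_scaleC:
  fixes M :: "'a \<Rightarrow>\<^sub>L 'a"
  assumes M: "\<And>k z. M (scaleC k z) = scaleC k (M z)"
  shows "blinfun_apply ((ad a b ^^ n) M) (scaleC k z) = scaleC k ((ad a b ^^ n) M z)"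
    and "blinfun_apply ((ad (scaleC l a) b ^^ n) M) z = scaleC (l ^ n) ((ad a b ^^ n) M z)"
proof -
  show hom: "blinfun_apply ((ad a b ^^ n) M) (scaleC k z) = scaleC k ((ad a b ^^ n) M z)" for k z n
    by (induction n arbitrary: z) (simp_all add: M ad_apply trip_scaleC_right scale_right_diff_distrib)
  show "blinfun_apply ((ad (scaleC l a) b ^^ n) M) z = scaleC (l ^ n) ((ad a b ^^ n) M z)"
    by (induction n arbitrary: z)
       (simp_all add: ad_apply trip_scaleC_left trip_scaleC_right hom scale_right_diff_distrib mult_ac)
qed

text \<open>
  The conjugate of \<open>L(x, y)\<close> by \<open>exp (l L(a, b))\<close> is the exponential series of \<open>l ad\<close> at \<open>L(x, y)\<close>,
  an entire function of \<open>l\<close>. If it is bounded, its coefficient of degree \<open>1\<close>, which is the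
  commutator, vanishes by Liouville's theorem.
\<close>

lemma commute_if_conjugates_bounded:
  assumes B: "\<And>l. norm (trip (expo (trip (scaleC l a) b) x)
                 (expo (\<lambda>u. - trip b (scaleC l a) u) y) z) \<le> B"
  shows "trip a b (trip x y z) = trip x y (trip a b z)"
proof -
  let ?c = "\<lambda>n. blinfun_apply (expo_term (ad a b) (box x y) n) z"
  have coeff_scaleC: "scaleC (l ^ n) (?c n)
      = blinfun_apply (expo_term (ad (scaleC l a) b) (box x y) n) z" for l n
    by (simp add: expo_term_def blinfun.scaleR_left funpow_ad_scaleC trip_scaleC_right
        linear_scale[OF bounded_linear.linear[OF bounded_linear_scaleC_right]])
  have sums: "summable (\<lambda>n. norm (expo_term (ad a b) M n))" for a b M
    by (rule summable_norm_expo_term[OF bounded_linear_ad])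
  have "?c 1 = 0"
  proof (rule bounded_entire_series_coeff_zero)
    fix l :: complex
    have "(\<Sum>n. scaleC (l ^ n) (?c n)) = blinfun_apply (expo (ad (scaleC l a) b) (box x y)) z"
      unfolding coeff_scaleC expo_def
      by (rule bounded_linear.suminf[symmetric, OF blinfun.bounded_linear_left])
         (rule summable_norm_cancel[OF sums])
    also have "\<dots> = trip (expo (trip (scaleC l a) b) x) (expo (\<lambda>u. - trip b (scaleC l a) u) y) z"
      by (simp flip: box_expo)
    finally show "norm (\<Sum>n. scaleC (l ^ n) (?c n)) \<le> B"
      using B by simp
  next
    fix r :: real assume "r > 0"
    have "r ^ n * norm (?c n) \<le> norm (expo_term (ad (scaleC r a) b) (box x y) n) * norm z" for n
    proof -
      have "r ^ n * norm (?c n) = norm (scaleC (complex_of_real r ^ n) (?c n))"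
        using \<open>r > 0\<close> by (simp add: norm_scaleC norm_power)
      also have "\<dots> \<le> norm (expo_term (ad (scaleC r a) b) (box x y) n) * norm z"
        unfolding coeff_scaleC by (rule norm_blinfun)
      finally show ?thesis .
    qed
    then show "summable (\<lambda>n. r ^ n * norm (?c n))"
      using \<open>r > 0\<close>
      by (intro summable_comparison_test'[OF summable_mult2[OF sums]]) auto
  qed simp
  then show ?thesis by (simp add: expo_term_def ad_apply)
qed

section \<open>Dyadic powers in a homotope\<close>

text \<open>
  In the Jordan algebra with product \<open>(u, v) \<mapsto> {u, q, v}\<close>, the homotope at \<open>q\<close>, this is the
  power of \<open>p\<close> with exponent \<open>2 ^ n\<close>.
\<close>

definition dyadic_power :: "'a \<Rightarrow> 'a \<Rightarrow> nat \<Rightarrow> 'a" where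
  "dyadic_power p q n = ((\<lambda>u. trip u q u) ^^ n) p"

text \<open>
  Only powers with exponent \<open>2 ^ n\<close> are used, since repeated squaring accumulates a single factor:
  writing the bound as \<open>M X\<close> makes the inequality \<open>sq\<close> carry \<open>M X ^ 2 ^ (n + 1)\<close> exactly to
  \<open>M X ^ 2 ^ n\<close>.
\<close>

lemma norm_trip_le_dyadic_root:
  assumes M: "M > 0"
    and sq: "\<And>p q z. (norm (trip p q z))\<^sup>2 \<le> M * norm z * norm (trip (trip p q p) q z)"
    and X: "X \<ge> 0"
    and "\<And>z. norm (trip (dyadic_power p q n) q z) \<le> M * X ^ 2 ^ n * norm z"
  shows "norm (trip p q z) \<le> M * X * norm z"
  using assms(4)
proof (induction n arbitrary: z)
  case 0
  then show ?case by (simp add: dyadic_power_def)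
next
  case (Suc n)
  let ?u = "dyadic_power p q n"
  have "norm (trip ?u q w) \<le> M * X ^ 2 ^ n * norm w" for w
  proof (rule power2_le_imp_le)
    have "(norm (trip ?u q w))\<^sup>2 \<le> M * norm w * norm (trip (dyadic_power p q (Suc n)) q w)"
      using sq[of ?u q w] by (simp add: dyadic_power_def)
    also have "\<dots> \<le> M * norm w * (M * X ^ 2 ^ Suc n * norm w)"
      using M Suc.prems by (intro mult_left_mono) auto
    also have "\<dots> = (M * X ^ 2 ^ n * norm w)\<^sup>2"
      by (simp add: power2_eq_square power_add[symmetric] mult_2 mult_ac)
    finally show "(norm (trip ?u q w))\<^sup>2 \<le> (M * X ^ 2 ^ n * norm w)\<^sup>2" .
    show "0 \<le> M * X ^ 2 ^ n * norm w" using M X by simp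
  qed
  then show ?case by (rule Suc.IH)
qed

lemma norm_dyadic_power_le:
  assumes "K \<ge> 0" and K: "\<And>a b c. norm (trip a b c) \<le> K * norm a * norm b * norm c"
  shows "norm (dyadic_power y x n) \<le> ((1 + K * norm x) * norm y) ^ 2 ^ n"
proof -
  let ?k = "1 + K * norm x"
  have k: "?k \<ge> 1" using \<open>K \<ge> 0\<close> by simp
  \<comment> \<open>The additional factor on the left makes the induction step a plain squaring.\<close>
  have "?k * norm (dyadic_power y x n) \<le> (?k * norm y) ^ 2 ^ n"
  proof (induction n)
    case 0
    then show ?case by (simp add: dyadic_power_def)
  next
    case (Suc n)
    let ?u = "dyadic_power y x n"
    have "norm (trip ?u x ?u) \<le> K * norm x * (norm ?u)\<^sup>2"
      using K[of ?u x ?u] by (simp add: power2_eq_square mult_ac)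
    also have "\<dots> \<le> ?k * (norm ?u)\<^sup>2" by (intro mult_right_mono) auto
    finally have "?k * norm (trip ?u x ?u) \<le> ?k * (?k * (norm ?u)\<^sup>2)"
      using k by (intro mult_left_mono) auto
    also have "\<dots> = (?k * norm ?u)\<^sup>2" by (simp add: power2_eq_square mult_ac)
    also have "\<dots> \<le> ((?k * norm y) ^ 2 ^ n)\<^sup>2"
      using k by (intro power_mono Suc.IH) auto
    also have "\<dots> = (?k * norm y) ^ 2 ^ Suc n"
      by (simp add: power_mult[symmetric] mult.commute)
    finally show ?case by (simp add: dyadic_power_def)
  qed
  moreover have "norm (dyadic_power y x n) \<le> ?k * norm (dyadic_power y x n)"
    using mult_right_mono[OF k, of "norm (dyadic_power y x n)"] by simp
  ultimately show ?thesis by linarith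
qed

lemma dyadic_power_expo:
  "dyadic_power (expo (trip a b) y) (expo (\<lambda>u. - trip b a u) x) n
    = expo (trip a b) (dyadic_power y x n)"
  by (induction n) (simp_all add: dyadic_power_def trip_expo)

end

section \<open>Quasi-commuting triple products\<close>

locale quasi_commuting_triple = JB_star_triple +
  fixes \<gamma> :: real
  assumes \<gamma>_pos: "\<gamma> > 0"
    and quasi_commute: "norm (trip a b (trip x y z)) \<le> \<gamma> * norm (trip x y (trip a b z))"
begin

text \<open>
  In a product of five entries such as \<open>{a, b, {x, y, z}}\<close> the hypothesis exchanges the pairs
  \<open>(a, b)\<close> and \<open>(x, y)\<close>, and the symmetry of the outer slots allows \<open>z\<close> to take part. For
  \<open>v = {p, q, z}\<close> one thus passes from \<open>{v, v, {p, q, z}}\<close> to \<open>{z, v, {p, q, v}}\<close>, which frees a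
  \<open>v\<close> to be expanded next to \<open>p\<close> and \<open>q\<close>, and from \<open>{p, q, {p, q, z}}\<close> to \<open>{z, q, {p, q, p}}\<close>.
\<close>

lemma norm_trip_squared_le:
  "\<exists>M>0. \<forall>p q z. (norm (trip p q z))\<^sup>2 \<le> M * norm z * norm (trip (trip p q p) q z)"
proof -
  obtain K where K: "K > 0" "\<And>a b c. norm (trip a b c) \<le> K * norm a * norm b * norm c"
    using norm_trip_le by blast
  let ?M = "\<gamma> * \<gamma> * K * \<gamma>"
  have "(norm (trip p q z))\<^sup>2 \<le> ?M * norm z * norm (trip (trip p q p) q z)" for p q z
  proof -
    define v where "v = trip p q z"
    have "norm v ^ 3 = norm (trip v v (trip p q z))" by (simp add: v_def norm_cube)
    also have "\<dots> \<le> \<gamma> * norm (trip p q (trip z v v))"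
      using quasi_commute symmetric_outer[of v v z] by metis
    also have "\<dots> \<le> \<gamma> * (\<gamma> * norm (trip z v (trip p q v)))"
      using \<gamma>_pos by (intro mult_left_mono quasi_commute) auto
    also have "\<dots> \<le> \<gamma> * (\<gamma> * (K * norm z * norm v * norm (trip p q v)))"
      using \<gamma>_pos K by (intro mult_left_mono) auto
    also have "\<dots> \<le> \<gamma> * (\<gamma> * (K * norm z * norm v * (\<gamma> * norm (trip (trip p q p) q z))))"
    proof -
      have "norm (trip p q v) \<le> \<gamma> * norm (trip (trip p q p) q z)"
        unfolding v_def using quasi_commute[of p q z q p] symmetric_outer by metis
      then show ?thesis using \<gamma>_pos K by (intro mult_left_mono) auto
    qed
    finally have "norm v * (norm v)\<^sup>2 \<le> norm v * (?M * norm z * norm (trip (trip p q p) q z))"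
      by (simp add: power3_eq_cube power2_eq_square mult_ac)
    moreover have "0 \<le> ?M * norm z * norm (trip (trip p q p) q z)"
      using \<gamma>_pos K by simp
    ultimately show ?thesis
      by (cases "v = 0") (auto simp flip: v_def)
  qed
  then show ?thesis using \<gamma>_pos K by (intro exI[of _ ?M]) auto
qed

text \<open>
  The bound must not depend on \<open>a\<close> and \<open>b\<close>. The norms of the exponentials, which do depend on them,
  only enter through the factor \<open>G\<close> below, and this is absorbed by \<open>2 ^ 2 ^ n\<close> for large \<open>n\<close>.
\<close>

lemma conjugates_bounded:
  "\<exists>B. \<forall>a b. norm (trip (expo (trip a b) y) (expo (\<lambda>u. - trip b a u) x) z) \<le> B"
proof -
  obtain K where K: "K > 0" "\<And>a b c. norm (trip a b c) \<le> K * norm a * norm b * norm c"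
    using norm_trip_le by blast
  obtain M where M: "M > 0"
    "\<And>p q z. (norm (trip p q z))\<^sup>2 \<le> M * norm z * norm (trip (trip p q p) q z)"
    using norm_trip_squared_le by blast
  define s where "s = (1 + K * norm x) * norm y"
  have s: "s \<ge> 0" using K by (simp add: s_def)
  have "norm (trip (expo (trip a b) y) (expo (\<lambda>u. - trip b a u) x) z) \<le> M * (2 * s) * norm z" for a b
  proof -
    let ?p = "expo (trip a b) y" and ?q = "expo (\<lambda>u. - trip b a u) x"
    obtain C where C: "C \<ge> 0" "\<And>u. norm (expo (trip a b) u) \<le> C * norm u"
      using norm_expo_le[OF bounded_linear_trip] by blast
    define G where "G = K * C * norm ?q"
    obtain n where "G / M < 2 ^ n" using real_arch_pow[of 2 "G / M"] by auto
    also have "(2::real) ^ n \<le> 2 ^ 2 ^ n" by (intro power_increasing) auto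
    finally have n: "G / M \<le> 2 ^ 2 ^ n" by simp
    have bound: "norm (trip (dyadic_power ?p ?q n) ?q w) \<le> M * (2 * s) ^ 2 ^ n * norm w" for w
    proof -
      have "norm (dyadic_power ?p ?q n) \<le> C * norm (dyadic_power y x n)"
        unfolding dyadic_power_expo by (rule C)
      also have "\<dots> \<le> C * s ^ 2 ^ n"
        unfolding s_def using C K by (intro mult_left_mono norm_dyadic_power_le) auto
      finally have *: "norm (dyadic_power ?p ?q n) \<le> C * s ^ 2 ^ n" .
      have "norm (trip (dyadic_power ?p ?q n) ?q w)
          \<le> K * norm (dyadic_power ?p ?q n) * norm ?q * norm w"
        by (rule K)
      also have "\<dots> \<le> K * (C * s ^ 2 ^ n) * norm ?q * norm w"
        using K * by (intro mult_right_mono mult_left_mono) auto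
      also have "\<dots> = M * (G / M * s ^ 2 ^ n) * norm w"
        using M by (simp add: G_def)
      also have "\<dots> \<le> M * (2 ^ 2 ^ n * s ^ 2 ^ n) * norm w"
        using M s n by (intro mult_right_mono mult_left_mono) auto
      finally show ?thesis by (simp add: power_mult_distrib)
    qed
    show ?thesis
      by (rule norm_trip_le_dyadic_root[OF M _ bound]) (use s in simp)
  qed
  then show ?thesis by blast
qed

lemma commutative: "commutative_triple trip"
  unfolding commutative_triple_def
proof (intro allI ext)
  fix a b x y z
  obtain B where "\<And>a b. norm (trip (expo (trip a b) x) (expo (\<lambda>u. - trip b a u) y) z) \<le> B"
    using conjugates_bounded by blast
  then have "trip a b (trip x y z) = trip x y (trip a b z)"
    by (intro commute_if_conjugates_bounded)
  then show "(trip a b \<circ> trip x y) z = (trip x y \<circ> trip a b) z"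
    by simp
qed

end

theorem theorem1p2:
  fixes scaleC :: "complex \<Rightarrow> 'a::banach \<Rightarrow> 'a"
    and trip :: "'a \<Rightarrow> 'a \<Rightarrow> 'a \<Rightarrow> 'a"
  assumes "JB_star_triple scaleC trip"
  shows "commutative_triple trip \<longleftrightarrow>
    (\<exists>\<gamma>::real. \<gamma> > 0 \<and>
      (\<forall>a b x y z. norm (trip a b (trip x y z)) \<le> \<gamma> * norm (trip x y (trip a b z))))"
proof
  assume "commutative_triple trip"
  then have "trip a b (trip x y z) = trip x y (trip a b z)" for a b x y z
    by (metis commutative_triple_def comp_apply)
  then show "\<exists>\<gamma>::real. \<gamma> > 0 \<and>
      (\<forall>a b x y z. norm (trip a b (trip x y z)) \<le> \<gamma> * norm (trip x y (trip a b z)))"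
    by (intro exI[of _ 1]) auto
next
  assume "\<exists>\<gamma>::real. \<gamma> > 0 \<and>
      (\<forall>a b x y z. norm (trip a b (trip x y z)) \<le> \<gamma> * norm (trip x y (trip a b z)))"
  then obtain \<gamma> where "quasi_commuting_triple scaleC trip \<gamma>"
    using assms by (auto simp: quasi_commuting_triple_def quasi_commuting_triple_axioms_def)
  then show "commutative_triple trip"
    by (rule quasi_commuting_triple.commutative)
qed

end
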